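(* Every simplex embeds into a regular polygonal torus. That is, for every finite affinely independent set $X\subset\mathbb{R}^k$ there exist $n\in\mathbb{N}$ and regular polygons $T_1,\dots,T_n\subset\mathbb{R}^2$ and a map $f:X\to \prod_{i=1}^n T_i\subseteq\mathbb{R}^{2n}$ such that $\|f(x)-f(x')\|=\|x-x'\|$ for all $x,x'\in X$.
   Context: A simplex is a finite set of affinely independent points in some Euclidean space $\mathbb{R}^k$ (with the usual Euclidean norm $\|\cdot\|$). A regular polygon here means the set of vertices of a regular $m$-gon in $\mathbb{R}^2$ ($m\geq 2$). A regular polygonal torus is a product $\prod_{i=1}^n T_i=\{(t_i)_{i=1}^n: t_i\in T_i\}\subseteq\mathbb{R}^{2n}$ of finitely many regular polygons $T_i\subset\mathbb{R}^2$. A set $X\subset\mathbb{R}^k$ embeds into $Y\subset\mathbb{R}^m$ if there is $f:X\to Y$ with $\|f(x)-f(x')\|=\|x-x'\|$ for all $x,x'\in X$. *)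

theory Defs
  imports "HOL-Analysis.Analysis"
begin

text \<open>
  The vertex set of a regular \<open>m\<close>-gon with arbitrary centre \<open>c\<close>, circumradius \<open>r\<close> and rotation
  angle \<open>\<theta>\<close>. For \<open>m = 2\<close> this is a pair of distinct points.
\<close>

definition regular_polygon :: "(real^2) set \<Rightarrow> bool" where
  "regular_polygon P \<longleftrightarrow>
     (\<exists>(m::nat) (c::real^2) (r::real) (\<theta>::real). 2 \<le> m \<and> 0 < r \<and>
        P = {c + r *\<^sub>R vector [cos (\<theta> + 2 * pi * real j / real m),
                              sin (\<theta> + 2 * pi * real j / real m)] | j::nat. j < m})"

text \<open>
  A point of \<open>\<real>\<^sup>2\<^sup>n\<close> is represented by its family of \<open>n\<close> planar components, indexed by
  \<open>{1..n}\<close> (and extensional outside), since \<open>n\<close> has to be quantified inside the formula. So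
  \<open>\<Pi>\<^sub>E i\<in>{1..n}. T i\<close> is the polygonal torus, and the Euclidean distance is the square root of the
  sum of the squared distances of the planar components.
\<close>

definition component_dist :: "nat \<Rightarrow> (nat \<Rightarrow> real^2) \<Rightarrow> (nat \<Rightarrow> real^2) \<Rightarrow> real" where
  "component_dist n u v = L2_set (\<lambda>i. norm (u i - v i)) {1..n}"

definition regular_polygonal_torus :: "nat \<Rightarrow> (nat \<Rightarrow> real^2) set \<Rightarrow> bool" where
  "regular_polygonal_torus n Y \<longleftrightarrow>
     (\<exists>T. (\<forall>i\<in>{1..n}. regular_polygon (T i)) \<and> Y = (\<Pi>\<^sub>E i\<in>{1..n}. T i))"

end

theory Submission
  imports Defs
begin

text \<open>
  The squared distance arrays realised in polygonal tori form a convex cone \<open>C\<close>. A regular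
  \<open>n\<^sup>2\<close>-gon of radius \<open>n\<close> looks like a fine grid on a line, so the closure of \<open>C\<close> contains all
  arrays \<open>(g i - g j)\<^sup>2\<close>, hence all squared Euclidean distance arrays. If the array \<open>D\<close> of a simplex
  were not in the relative interior of \<open>C\<close>, some functional \<open>a\<close> would be nonnegative on \<open>C\<close>, not
  identically zero there, and \<open>\<le> 0\<close> at \<open>D\<close>. Then \<open>q g = (\<Sum>i j. a i j * (g i - g j)\<^sup>2)\<close> is a positive
  semidefinite form vanishing at the coordinate functions of the simplex. By affine independence
  these span all functions modulo constants, so \<open>q = 0\<close> and \<open>a\<close> vanishes on \<open>C\<close>, a contradiction.
\<close>

section \<open>Squared distance arrays\<close>

text \<open>Arrays are vectors over a finite index type, so that linear functionals on them are
  inner products and the convex geometry of Euclidean spaces applies.\<close>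

definition sqdist :: "('i::finite \<Rightarrow> 'a::real_normed_vector) \<Rightarrow> real^('i \<times> 'i)" where
  "sqdist f = (\<chi> z. (norm (f (fst z) - f (snd z)))\<^sup>2)"

text \<open>A single polygon suffices here: by Pythagoras, a product of polygons adds up the arrays
  of its factors, so tori correspond to the convex hull of this cone.\<close>

definition polygon_sqdists :: "(real^('i::finite \<times> 'i)) set" where
  "polygon_sqdists = {sqdist f | f P. regular_polygon P \<and> range f \<subseteq> P}"

lemma sqdist_nth [simp]: "sqdist f $ (i, j) = (norm (f i - f j))\<^sup>2"
  by (simp add: sqdist_def)

lemma sqdist_const [simp]: "sqdist (\<lambda>i. c) = 0"
  by (simp add: vec_eq_iff sqdist_def)

lemma sqdist_add_const [simp]: "sqdist (\<lambda>i. f i + c) = sqdist f"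
  by (simp add: sqdist_def)

lemma sqdist_scaleR: "sqdist (\<lambda>i. c *\<^sub>R f i) = c\<^sup>2 *\<^sub>R sqdist f"
  by (simp add: vec_eq_iff sqdist_def flip: scaleR_diff_right add: power_mult_distrib)

lemma norm_sq_eq_sum_Basis: "(norm (x::'a::euclidean_space))\<^sup>2 = (\<Sum>b\<in>Basis. (x \<bullet> b)\<^sup>2)"
  by (subst power2_norm_eq_inner, subst euclidean_inner) (simp add: power2_eq_square)

lemma sqdist_eq_sum_Basis:
  fixes f :: "'i::finite \<Rightarrow> 'a::euclidean_space"
  shows "sqdist f = (\<Sum>b\<in>Basis. sqdist (\<lambda>i. f i \<bullet> b))"
  by (simp add: vec_eq_iff norm_sq_eq_sum_Basis inner_diff_left)

text \<open>Lets a nonnegative functional of \<open>sqdist\<close> be treated as a quadratic form: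
  its null set becomes closed under addition.\<close>

lemma sqdist_parallelogram:
  fixes f g :: "'i::finite \<Rightarrow> real"
  shows "sqdist (\<lambda>i. f i + g i) + sqdist (\<lambda>i. f i - g i) = 2 *\<^sub>R sqdist f + 2 *\<^sub>R sqdist g"
  by (simp add: vec_eq_iff power2_eq_square algebra_simps)

section \<open>The cone of polygonal tori\<close>

lemma regular_polygon_scaleR:
  assumes "regular_polygon P" "0 < s"
  shows "regular_polygon ((*\<^sub>R) s ` P)"
proof -
  obtain m c r \<theta> where *: "2 \<le> m" "0 < r"
    "P = {c + r *\<^sub>R vector [cos (\<theta> + 2 * pi * real j / real m),
                              sin (\<theta> + 2 * pi * real j / real m)] | j::nat. j < m}"
    using assms(1) unfolding regular_polygon_def by blast
  have "(*\<^sub>R) s ` P = {s *\<^sub>R c + (s * r) *\<^sub>R vector [cos (\<theta> + 2 * pi * real j / real m),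
                              sin (\<theta> + 2 * pi * real j / real m)] | j::nat. j < m}"
    unfolding *(3) setcompr_eq_image image_image by (simp add: scaleR_add_right)
  then show ?thesis
    unfolding regular_polygon_def using *(1,2) assms(2)
    by (intro exI[of _ m] exI[of _ "s *\<^sub>R c"] exI[of _ "s * r"] exI[of _ \<theta>] conjI) simp_all
qed

lemma regular_polygon_nonempty: "regular_polygon P \<Longrightarrow> P \<noteq> {}"
  unfolding regular_polygon_def by force

lemma cone_polygon_sqdists: "cone (polygon_sqdists :: (real^('i::finite \<times> 'i)) set)"
  unfolding cone_def
proof (intro ballI allI impI)
  fix d :: "real^('i \<times> 'i)" and c :: real
  assume "d \<in> polygon_sqdists" "0 \<le> c"
  then obtain f P where f: "d = sqdist f" "regular_polygon P" "range f \<subseteq> P"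
    unfolding polygon_sqdists_def by auto
  show "c *\<^sub>R d \<in> polygon_sqdists"
  proof (cases "c = 0")
    \<comment> \<open>Scaling by 0 would collapse the polygon to a point, which is not a regular
      polygon; a constant map into the old one gives the zero array instead.\<close>
    case True
    obtain v where "v \<in> P" using regular_polygon_nonempty f(2) by blast
    then have "range (\<lambda>i::'i. v) \<subseteq> P" by auto
    moreover have "c *\<^sub>R d = sqdist (\<lambda>i::'i. v)" using True by simp
    ultimately show ?thesis unfolding polygon_sqdists_def using f(2) by blast
  next
    case False
    then have "c *\<^sub>R d = sqdist (\<lambda>i. sqrt c *\<^sub>R f i)"
      using \<open>0 \<le> c\<close> by (simp add: sqdist_scaleR f)
    moreover have "regular_polygon ((*\<^sub>R) (sqrt c) ` P)"
      using False \<open>0 \<le> c\<close> f by (intro regular_polygon_scaleR) auto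
    moreover have "range (\<lambda>i. sqrt c *\<^sub>R f i) \<subseteq> (*\<^sub>R) (sqrt c) ` P" using f by auto
    ultimately show ?thesis unfolding polygon_sqdists_def by blast
  qed
qed

section \<open>Approximating the line by large regular polygons\<close>

definition ngon :: "nat \<Rightarrow> real \<Rightarrow> (real^2) set" where
  "ngon m r = {r *\<^sub>R vector [cos (2 * pi * real j / real m), sin (2 * pi * real j / real m)] | j. j < m}"

lemma regular_polygon_ngon: "2 \<le> m \<Longrightarrow> 0 < r \<Longrightarrow> regular_polygon (ngon m r)"
  unfolding regular_polygon_def ngon_def
  by (rule exI[of _ m], rule exI[of _ 0], rule exI[of _ r], rule exI[of _ 0]) simp

text \<open>Reducing \<open>a\<close> modulo \<open>m\<close> changes the angle by full turns only.
  Hence floors of any sign and size can serve as vertex numbers.\<close>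

lemma ngon_int_mem:
  assumes "0 < m"
  shows "r *\<^sub>R vector [cos (2 * pi * real_of_int a / real m), sin (2 * pi * real_of_int a / real m)]
    \<in> ngon m r"
proof -
  define j where "j = nat (a mod int m)"
  define k where "k = a div int m"
  have "a = k * int m + int j" using assms by (simp add: j_def k_def)
  then have "2 * pi * real_of_int a / real m = 2 * pi * real j / real m + 2 * pi * real_of_int k"
    using assms by (simp add: field_simps)
  moreover have "cos (x + 2 * pi * real_of_int k) = cos x"
    "sin (x + 2 * pi * real_of_int k) = sin x" for x
    using sin_int_2pin[of k] cos_int_2pin[of k] by (simp_all add: cos_add sin_add)
  moreover have "j < m" using assms by (simp add: j_def nat_less_iff)
  ultimately show ?thesis unfolding ngon_def by auto
qed

lemma norm_circle_diff_sq:
  "(norm (r *\<^sub>R (vector [cos x, sin x] :: real^2) - r *\<^sub>R vector [cos y, sin y]))\<^sup>2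
     = (2 * r * sin ((x - y) / 2))\<^sup>2"
proof -
  have "(norm (r *\<^sub>R (vector [cos x, sin x] :: real^2) - r *\<^sub>R vector [cos y, sin y]))\<^sup>2
      = (r * cos x - r * cos y)\<^sup>2 + (r * sin x - r * sin y)\<^sup>2"
    unfolding power2_norm_eq_inner by (simp add: inner_vec_def sum_2 power2_eq_square)
  also have "\<dots> = r\<^sup>2 * ((cos x)\<^sup>2 + (sin x)\<^sup>2 + ((cos y)\<^sup>2 + (sin y)\<^sup>2) - 2 * cos (x - y))"
    unfolding cos_diff by algebra
  also have "\<dots> = r\<^sup>2 * (2 - 2 * cos (x - y))" by simp
  also have "cos (x - y) = 1 - 2 * (sin ((x - y) / 2))\<^sup>2"
    by (subst cos_double_sin[symmetric]) (simp only: times_divide_eq_right nonzero_mult_div_cancel_left)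
  also have "r\<^sup>2 * (2 - 2 * (1 - 2 * (sin ((x - y) / 2))\<^sup>2)) = (2 * r * sin ((x - y) / 2))\<^sup>2"
    by (simp add: power_mult_distrib)
  finally show ?thesis .
qed

text \<open>This is the signed chord over an arc of length \<open>t n\<close> on a circle of radius
  \<open>n\<close>; chord and arc agree in the limit as the curvature vanishes.\<close>

lemma tendsto_scaled_sin:
  assumes "t \<longlonglongrightarrow> (l::real)"
  shows "(\<lambda>n. 2 * real n * sin (t n / (2 * real n))) \<longlonglongrightarrow> l"
proof -
  \<comment> \<open>Caratheodory's form of the derivative avoids dividing by \<open>t n\<close>,
    which may be 0.\<close>
  obtain s :: "real \<Rightarrow> real" where s: "\<And>z. sin z = s z * z" "isCont s 0" "s 0 = 1"
    using DERIV_sin[of "0::real"] unfolding CARAT_DERIV by auto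
  have "(\<lambda>n. t n / 2 * inverse (real n)) \<longlonglongrightarrow> l / 2 * 0"
    by (intro tendsto_intros assms lim_inverse_n) simp
  moreover have "t n / 2 * inverse (real n) = t n / (2 * real n)" for n
    by (cases "n = 0") (simp_all add: field_simps)
  ultimately have "(\<lambda>n. t n / (2 * real n)) \<longlonglongrightarrow> 0"
    by (simp only: mult_zero_right)
  then have "(\<lambda>n. s (t n / (2 * real n)) * t n) \<longlonglongrightarrow> s 0 * l"
    by (intro tendsto_mult assms isCont_tendsto_compose[OF s(2)])
  then have "(\<lambda>n. s (t n / (2 * real n)) * t n) \<longlonglongrightarrow> l"
    by (simp only: s(3) mult_1)
  moreover have "\<forall>\<^sub>F n in sequentially. s (t n / (2 * real n)) * t n = 2 * real n * sin (t n / (2 * real n))"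
    using eventually_gt_at_top[of 0] by eventually_elim (simp add: s(1)[of "_ / _"])
  ultimately show ?thesis by (rule Lim_transform_eventually)
qed

lemma tendsto_floor_mult_div: "(\<lambda>n. real_of_int \<lfloor>real n * x\<rfloor> / real n) \<longlonglongrightarrow> x"
proof (rule real_tendsto_sandwich)
  show "\<forall>\<^sub>F n in sequentially. x - 1 / real n \<le> real_of_int \<lfloor>real n * x\<rfloor> / real n"
    using eventually_gt_at_top[of 0]
  proof eventually_elim
    case (elim n)
    then have "x - 1 / real n = (real n * x - 1) / real n" by (simp add: field_simps)
    also have "\<dots> \<le> real_of_int \<lfloor>real n * x\<rfloor> / real n"
      by (intro divide_right_mono) linarith+
    finally show ?case .
  qed
  show "\<forall>\<^sub>F n in sequentially. real_of_int \<lfloor>real n * x\<rfloor> / real n \<le> x"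
    using eventually_gt_at_top[of 0]
  proof eventually_elim
    case (elim n)
    then show ?case using of_int_floor_le[of "real n * x"] by (simp add: field_simps)
  qed
  show "(\<lambda>n. x - 1 / real n) \<longlonglongrightarrow> x"
    using tendsto_diff[OF tendsto_const lim_1_over_n, of x] by simp
qed simp

text \<open>Rounding \<open>g\<close> to the vertices of a regular \<open>n\<^sup>2\<close>-gon of radius \<open>n\<close>, whose side length tends
  to \<open>0\<close> while its curvature vanishes.\<close>

lemma sqdist_real_in_closure:
  fixes g :: "'i::finite \<Rightarrow> real"
  shows "sqdist g \<in> closure polygon_sqdists"
proof -
  \<comment> \<open>Neighbouring vertices of the \<open>n\<^sup>2\<close>-gon of radius
    \<open>n\<close> are an arc \<open>2 * pi / n\<close> apart, so vertex number
    \<open>a n i\<close> sits at arc length close to \<open>g i\<close>.\<close>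
  define a where "a n i = \<lfloor>real n * (g i / (2 * pi))\<rfloor>" for n i
  define \<phi> where "\<phi> n i = 2 * pi * real_of_int (a n i) / real (n\<^sup>2)" for n i
  define f where "f n i = real n *\<^sub>R (vector [cos (\<phi> n i), sin (\<phi> n i)] :: real^2)" for n i
  have mem: "sqdist (f n) \<in> polygon_sqdists" if "n \<ge> 2" for n
  proof -
    have "2 \<le> n\<^sup>2" using that self_le_power[of n 2] by simp
    then have "regular_polygon (ngon (n\<^sup>2) (real n))" "range (f n) \<subseteq> ngon (n\<^sup>2) (real n)"
      using that by (auto intro: regular_polygon_ngon ngon_int_mem simp: f_def \<phi>_def
          simp del: of_nat_power)
    then show ?thesis unfolding polygon_sqdists_def by blast
  qed
  have lim: "(\<lambda>n. 2 * pi * (real_of_int (a n i) / real n - real_of_int (a n j) / real n))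
      \<longlonglongrightarrow> 2 * pi * (g i / (2 * pi) - g j / (2 * pi))" for i j
    unfolding a_def by (intro tendsto_intros tendsto_floor_mult_div)
  have "(\<lambda>n. sqdist (f n) $ (i, j)) \<longlonglongrightarrow> sqdist g $ (i, j)" for i j
  proof -
    have "(\<lambda>n. (2 * real n * sin (2 * pi * (real_of_int (a n i) / real n - real_of_int (a n j) / real n) / (2 * real n)))\<^sup>2)
      \<longlonglongrightarrow> (2 * pi * (g i / (2 * pi) - g j / (2 * pi)))\<^sup>2"
      by (intro tendsto_power tendsto_scaled_sin lim)
    moreover have "2 * pi * (g i / (2 * pi) - g j / (2 * pi)) = g i - g j"
      by (simp add: field_simps)
    moreover have "sqdist (f n) $ (i, j) = (2 * real n * sin (2 * pi * (real_of_int (a n i) / real n - real_of_int (a n j) / real n) / (2 * real n)))\<^sup>2" for n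
    proof -
      have "(\<phi> n i - \<phi> n j) / 2 = 2 * pi * (real_of_int (a n i) / real n - real_of_int (a n j) / real n) / (2 * real n)"
        by (cases "n = 0") (simp_all add: \<phi>_def field_simps power2_eq_square)
      then show ?thesis
        by (simp only: sqdist_nth f_def norm_circle_diff_sq)
    qed
    ultimately show ?thesis by simp
  qed
  then have "(\<lambda>n. sqdist (f n)) \<longlonglongrightarrow> sqdist g"
    by (intro vec_tendstoI) (metis surj_pair)
  moreover have "\<forall>\<^sub>F n in sequentially. sqdist (f n) \<in> closure polygon_sqdists"
    using eventually_ge_at_top[of 2]
    by eventually_elim (use mem closure_subset in blast)
  ultimately show ?thesis
    by (intro Lim_in_closed_set[OF closed_closure _ sequentially_bot])
qed

section \<open>Separation\<close>

text \<open>\<open>aff\<close> is affine independence in dual form: the coordinate functions of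
  \<open>p\<close> and the constants span all functions on the index type.\<close>

lemma simplex_sqdist_in_hull:
  fixes p :: "'i::finite \<Rightarrow> 'a::euclidean_space"
  assumes aff: "\<And>h :: 'i \<Rightarrow> real. \<exists>u t. \<forall>i. h i = p i \<bullet> u + t"
  shows "sqdist p \<in> convex hull polygon_sqdists"
proof (rule ccontr)
  define C :: "(real^('i \<times> 'i)) set" where "C = convex hull polygon_sqdists"
  assume "sqdist p \<notin> convex hull polygon_sqdists"
  then have notin: "sqdist p \<notin> rel_interior C"
    using rel_interior_subset unfolding C_def by blast
  have cC: "convex C" unfolding C_def by simp
  have cl: "convex (closure C)" "cone (closure C)"
    unfolding C_def by (simp_all add: convex_closure cone_closure cone_convex_hull cone_polygon_sqdists)
  have sq: "sqdist g \<in> closure C" for g :: "'i \<Rightarrow> real"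
    using sqdist_real_in_closure[of g] closure_mono[OF hull_subset[of polygon_sqdists convex]]
    unfolding C_def by blast
  have zero: "0 \<in> closure C"
    using sq[of "\<lambda>_. 0"] by simp
  have add_cl: "x + y \<in> closure C" if "x \<in> closure C" "y \<in> closure C" for x y
    using convex_cone[of "closure C"] cl that by blast
  have sum_cl: "sum F A \<in> closure C" if "\<And>b. b \<in> A \<Longrightarrow> F b \<in> closure C" for F and A :: "'a set"
    using that
    by (induction A rule: infinite_finite_induct) (simp_all add: zero add_cl)
  have p_cl: "sqdist p \<in> closure C"
    by (subst sqdist_eq_sum_Basis) (rule sum_cl, rule sq)
  \<comment> \<open>The array is in the closure of \<open>C\<close> but not in its relative
    interior. The strict inequality forbids \<open>a\<close> from vanishing on all of
    \<open>C\<close>, which gives the final contradiction.\<close>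
  obtain a where "a \<noteq> 0" and a: "\<And>y. y \<in> closure C \<Longrightarrow> a \<bullet> sqdist p \<le> a \<bullet> y"
      "\<And>y. y \<in> rel_interior C \<Longrightarrow> a \<bullet> sqdist p < a \<bullet> y"
    using supporting_hyperplane_relative_frontier[OF cC p_cl notin] by metis
  have p_le: "a \<bullet> sqdist p \<le> 0" using a(1)[OF zero] by simp
  have nonneg: "0 \<le> a \<bullet> y" if "y \<in> closure C" for y
  proof (rule ccontr)
    assume neg: "\<not> 0 \<le> a \<bullet> y"
    \<comment> \<open>Chosen so that \<open>s * (a \<bullet> y)\<close> is one less than the lower
      bound \<open>a \<bullet> sqdist p\<close>.\<close>
    define s where "s = (1 - a \<bullet> sqdist p) / (- (a \<bullet> y))"
    have "0 \<le> s" unfolding s_def by (rule divide_nonneg_pos) (use neg p_le in linarith)+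
    then have "s *\<^sub>R y \<in> closure C" using cl(2) that by (simp add: cone_def)
    from a(1)[OF this] have "a \<bullet> sqdist p \<le> s * (a \<bullet> y)" by simp
    also have "s * (a \<bullet> y) = a \<bullet> sqdist p - 1" using neg by (simp add: s_def field_simps)
    finally show False by simp
  qed
  \<comment> \<open>The null space of a positive semidefinite form.\<close>
  define N where "N = {g :: 'i \<Rightarrow> real. a \<bullet> sqdist g = 0}"
  have coord: "(\<lambda>i. p i \<bullet> b) \<in> N" if "b \<in> Basis" for b
  proof -
    \<comment> \<open>Nonnegative terms with sum at most 0 all vanish.\<close>
    have "(\<Sum>b\<in>Basis. a \<bullet> sqdist (\<lambda>i. p i \<bullet> b)) \<le> 0"
      using p_le unfolding sqdist_eq_sum_Basis[of p] by (simp add: inner_sum_right)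
    then have "\<forall>b\<in>Basis. a \<bullet> sqdist (\<lambda>i. p i \<bullet> b) = 0"
      by (subst sum_nonneg_eq_0_iff[symmetric]) (auto intro!: antisym sum_nonneg nonneg sq)
    then show ?thesis using that by (simp add: N_def)
  qed
  have N_add: "(\<lambda>i. f i + g i) \<in> N" if "f \<in> N" "g \<in> N" for f g
  proof -
    have "a \<bullet> sqdist (\<lambda>i. f i + g i) + a \<bullet> sqdist (\<lambda>i. f i - g i) = 0"
      using that by (simp flip: inner_add_right add: sqdist_parallelogram)
        (simp add: inner_add_right N_def)
    then show ?thesis
      using nonneg[OF sq[of "\<lambda>i. f i + g i"]] nonneg[OF sq[of "\<lambda>i. f i - g i"]]
      by (simp add: N_def)
  qed
  have N_scale: "(\<lambda>i. c * f i) \<in> N" if "f \<in> N" for c f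
    using that sqdist_scaleR[of c f] by (simp add: N_def)
  have N_sum: "(\<lambda>i. \<Sum>b\<in>A. F b i) \<in> N" if "\<And>b. b \<in> A \<Longrightarrow> F b \<in> N" for F and A :: "'a set"
    using that
  proof (induction A rule: infinite_finite_induct)
    case (insert b A)
    then have "(\<lambda>i. F b i + (\<Sum>b\<in>A. F b i)) \<in> N" by (intro N_add) auto
    then show ?case using insert by simp
  qed (simp_all add: N_def)
  have N_all: "h \<in> N" for h
  proof -
    obtain u t where h: "\<And>i. h i = p i \<bullet> u + t" using aff by blast
    have "h = (\<lambda>i. (\<Sum>b\<in>Basis. (u \<bullet> b) * (p i \<bullet> b)) + t)"
      by (rule ext) (simp add: h euclidean_inner[of "p _" u] mult.commute)
    moreover have "(\<lambda>i. \<Sum>b\<in>Basis. (u \<bullet> b) * (p i \<bullet> b)) \<in> N"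
      by (intro N_sum N_scale coord)
    ultimately show ?thesis by (simp add: N_def)
  qed
  \<comment> \<open>A planar configuration splits into two coordinate functions, both in
    \<open>N\<close>.\<close>
  have "a \<bullet> d = 0" if d: "d \<in> polygon_sqdists" for d
  proof -
    obtain f :: "'i \<Rightarrow> real^2" where "d = sqdist f" using d unfolding polygon_sqdists_def by auto
    then show ?thesis
      using N_all by (subst \<open>d = _\<close>, subst sqdist_eq_sum_Basis) (simp add: inner_sum_right N_def)
  qed
  then have "C \<subseteq> {y. a \<bullet> y = 0}"
    unfolding C_def by (intro hull_minimal convex_hyperplane) auto
  then have sub: "closure C \<subseteq> {y. a \<bullet> y = 0}"
    by (rule closure_minimal) (rule closed_hyperplane)
  have "C \<noteq> {}" using zero by auto
  then obtain y where "y \<in> rel_interior C" using rel_interior_eq_empty[OF cC] by auto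
  moreover from this have "a \<bullet> y = 0" using rel_interior_subset_closure sub by blast
  moreover have "a \<bullet> sqdist p = 0" using p_cl sub by blast
  ultimately show False using a(2)[of y] by simp
qed

section \<open>Embedding simplices\<close>

text \<open>Differences from a base point \<open>z\<close> are linearly independent, so values on
  them extend to a linear functional, which is the inner product with some \<open>u\<close>.\<close>

lemma affine_independent_affine_extend:
  fixes T :: "'a::euclidean_space set" and h :: "'a \<Rightarrow> real"
  assumes "\<not> affine_dependent T"
  shows "\<exists>u t. \<forall>x\<in>T. h x = x \<bullet> u + t"
proof (cases "T = {}")
  case False
  then obtain z where z: "z \<in> T" by blast
  define B where "B = (\<lambda>x. x - z) ` (T - {z})"
  have "independent B"
    using assms affine_dependent_iff_dependent2[OF z] by (simp add: B_def)
  then obtain g where g: "linear g" "\<And>y. y \<in> B \<Longrightarrow> g y = h (y + z) - h z"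
    using linear_independent_extend[of B "\<lambda>y. h (y + z) - h z"] by blast
  define u where "u = adjoint g 1"
  have gu: "g y = y \<bullet> u" for y
    using adjoint_works[OF g(1), of y 1] by (simp add: u_def)
  have "h x = x \<bullet> u + (h z - z \<bullet> u)" if "x \<in> T" for x
  proof (cases "x = z")
    case False
    then have "g (x - z) = h x - h z" using that g(2)[of "x - z"] by (simp add: B_def)
    then show ?thesis by (simp add: gu inner_diff_left)
  qed simp
  then show ?thesis by blast
qed simp

theorem theorem1p2:
  fixes X :: "(real^'k) set"
  assumes "finite X" and "\<not> affine_dependent X"
  shows "\<exists>n Y. 1 \<le> n \<and> regular_polygonal_torus n Y \<and>
           (\<exists>f \<in> X \<rightarrow> Y. \<forall>x\<in>X. \<forall>x'\<in>X. component_dist n (f x) (f x') = norm (x - x'))"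
proof -
  \<comment> \<open>An affine basis has exactly \<open>CARD('k) + 1\<close> points, so it can be
    indexed by the finite type \<open>'k option\<close>; the embedding is then restricted to
    \<open>X\<close>.\<close>
  obtain T :: "(real^'k) set" where T: "\<not> affine_dependent T" "X \<subseteq> T" "affine hull T = UNIV"
    using extend_to_affine_basis[OF assms(2), of UNIV] by auto
  have finT: "finite T" using T(1) by (rule aff_independent_finite)
  have "int (card T) - 1 = aff_dim T" using aff_dim_affine_independent[OF T(1)] by simp
  also have "\<dots> = int CARD('k)" using T(3) aff_dim_affine_hull[of T] by simp
  finally have "card (UNIV :: 'k option set) = card T" by (simp add: card_UNIV_option)
  then obtain p where p: "bij_betw p (UNIV :: 'k option set) T"
    using finite_same_card_bij[of "UNIV :: 'k option set" T] finT by auto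
  have "sqdist p \<in> convex hull polygon_sqdists"
  proof (rule simplex_sqdist_in_hull)
    fix h :: "'k option \<Rightarrow> real"
    obtain u t where "\<forall>x\<in>T. h (inv p x) = x \<bullet> u + t"
      using affine_independent_affine_extend[OF T(1), of "\<lambda>x. h (inv p x)"] by blast
    then show "\<exists>u t. \<forall>i. h i = p i \<bullet> u + t"
      using p by (metis bij_betw_def inv_f_f rangeI)
  qed
  then obtain n :: nat and w y where y: "\<And>k. k \<in> {1..n} \<Longrightarrow> 0 \<le> w k \<and> y k \<in> polygon_sqdists"
      "sum w {1..n} = 1" "(\<Sum>k = 1..n. w k *\<^sub>R y k) = sqdist p"
    unfolding convex_hull_indexed by fast
  \<comment> \<open>The cone property absorbs each weight \<open>w k\<close> into the polygon,
    leaving a plain sum of arrays.\<close>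
  have "\<exists>F P. regular_polygon P \<and> range F \<subseteq> P \<and> w k *\<^sub>R y k = sqdist F" if "k \<in> {1..n}" for k
    using cone_polygon_sqdists y(1)[OF that] unfolding cone_def polygon_sqdists_def by blast
  then obtain F P where F: "\<And>k. k \<in> {1..n} \<Longrightarrow>
      regular_polygon (P k) \<and> range (F k) \<subseteq> P k \<and> w k *\<^sub>R y k = sqdist (F k)"
    by metis
  define f where "f x = (\<lambda>k\<in>{1..n}. F k (inv p x))" for x
  \<comment> \<open>Weights with sum 1 rule out the empty combination.\<close>
  have "1 \<le> n" using y(2) by (cases n) auto
  moreover have "regular_polygonal_torus n (\<Pi>\<^sub>E k\<in>{1..n}. P k)"
    unfolding regular_polygonal_torus_def using F by blast
  moreover have "f \<in> X \<rightarrow> (\<Pi>\<^sub>E k\<in>{1..n}. P k)"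
    using F by (fastforce simp: f_def)
  moreover have "component_dist n (f x) (f x') = norm (x - x')" if "x \<in> X" "x' \<in> X" for x x'
  proof -
    have inv: "p (inv p x) = x" "p (inv p x') = x'"
      using that T(2) p by (auto simp: bij_betw_def f_inv_into_f)
    have "(\<Sum>k = 1..n. (norm (f x k - f x' k))\<^sup>2) = (\<Sum>k = 1..n. sqdist (F k) $ (inv p x, inv p x'))"
      by (intro sum.cong) (simp_all add: f_def)
    also have "\<dots> = (\<Sum>k = 1..n. w k *\<^sub>R y k) $ (inv p x, inv p x')"
      using F by (simp add: sum_component)
    also have "\<dots> = (norm (x - x'))\<^sup>2"
      unfolding y(3) by (simp add: inv)
    finally show ?thesis by (simp add: component_dist_def L2_set_def)
  qed
  ultimately show ?thesis by blast
qed

end
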